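(* There exist infinitely many families $\mathcal{F}$ of graphs with $|\mathcal{F}| = 3$ such that the ratio $\frac{\mathrm{sat}(n,\mathcal{F})}{n}$ does not converge as $n \to \infty$.
   Context: For a family of graphs $\mathcal{F}$, a graph $G$ is $\mathcal{F}$-saturated if $G$ contains no copy (subgraph isomorphic to) of any graph in $\mathcal{F}$, but adding any edge to $G$ creates a copy of some graph in $\mathcal{F}$. $\mathrm{sat}(n,\mathcal{F})$ is the minimum number of edges in an $n$-vertex $\mathcal{F}$-saturated graph. *)

theory Defs
  imports Complex_Main
begin

text \<open>
  Finite simple graphs, given as a vertex set and a set of two-element edges. Taking vertices
  in \<^typ>\<open>nat\<close> loses nothing, as every finite graph is isomorphic to such a graph.
\<close>

type_synonym graph = "nat set \<times> nat set set"

abbreviation verts :: "graph \<Rightarrow> nat set" where "verts G \<equiv> fst G"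
abbreviation edges :: "graph \<Rightarrow> nat set set" where "edges G \<equiv> snd G"

definition vertex_pairs :: "nat set \<Rightarrow> nat set set" where
  "vertex_pairs V = {e. e \<subseteq> V \<and> card e = 2}"

definition fin_graphs :: "graph set" where
  "fin_graphs = {G. finite (verts G) \<and> edges G \<subseteq> vertex_pairs (verts G)}"

definition subgraph :: "graph \<Rightarrow> graph \<Rightarrow> bool" where
  "subgraph H G \<longleftrightarrow> H \<in> fin_graphs \<and> G \<in> fin_graphs \<and>
     verts H \<subseteq> verts G \<and> edges H \<subseteq> edges G"

definition graph_iso :: "(graph \<times> graph) set" where
  "graph_iso = {(G, H). G \<in> fin_graphs \<and> H \<in> fin_graphs \<and>
     (\<exists>f. bij_betw f (verts G) (verts H) \<and> (\<lambda>e. f ` e) ` edges G = edges H)}"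

text \<open>
  As usual, the graphs in a family are considered up to isomorphism: a family is a set of
  isomorphism classes. Otherwise relabelling a single family would already produce infinitely
  many families, and three copies of one graph would form a family of size three.
\<close>

definition iso_classes :: "graph set set" where
  "iso_classes = fin_graphs // graph_iso"

definition contains_copy :: "graph \<Rightarrow> graph \<Rightarrow> bool" where
  "contains_copy G H \<longleftrightarrow> (\<exists>H'. subgraph H' G \<and> (H, H') \<in> graph_iso)"

definition contains_member :: "graph \<Rightarrow> graph set set \<Rightarrow> bool" where
  "contains_member G \<F> \<longleftrightarrow> (\<exists>C\<in>\<F>. \<exists>H\<in>C. contains_copy G H)"

definition add_edge :: "nat set \<Rightarrow> graph \<Rightarrow> graph" where
  "add_edge e G = (verts G, insert e (edges G))"

definition saturated :: "graph set set \<Rightarrow> graph \<Rightarrow> bool" where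
  "saturated \<F> G \<longleftrightarrow> G \<in> fin_graphs \<and> \<not> contains_member G \<F> \<and>
     (\<forall>e \<in> vertex_pairs (verts G) - edges G. contains_member (add_edge e G) \<F>)"

text \<open>
  If no member of the family is edgeless, a saturated graph exists for every \<^term>\<open>n\<close>.
  If some member is edgeless, there is none for large \<^term>\<open>n\<close>, and
  the infimum is then a fixed number (the value at the empty set), so that
  \<open>sat n \<F> / n\<close> tends to \<open>0\<close>; this convention therefore creates no divergent family.
\<close>

definition sat :: "nat \<Rightarrow> graph set set \<Rightarrow> nat" where
  "sat n \<F> = Inf {card (edges G) | G. saturated \<F> G \<and> card (verts G) = n}"

lemma equiv_graph_iso: "equiv fin_graphs graph_iso"
proof (rule equivI)
  show "graph_iso \<subseteq> fin_graphs \<times> fin_graphs"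
    by (auto simp: graph_iso_def)
  show "refl_on fin_graphs graph_iso"
    by (auto simp: refl_on_def graph_iso_def intro!: exI[of _ id])
  show "sym graph_iso"
  proof (rule symI)
    fix G H assume "(G, H) \<in> graph_iso"
    then obtain f where G: "G \<in> fin_graphs" and H: "H \<in> fin_graphs"
      and f: "bij_betw f (verts G) (verts H)" and E: "(\<lambda>e. f ` e) ` edges G = edges H"
      by (auto simp: graph_iso_def)
    let ?g = "inv_into (verts G) f"
    have "?g ` f ` e = e" if "e \<in> edges G" for e
    proof -
      have "e \<subseteq> verts G" using that G by (auto simp: fin_graphs_def vertex_pairs_def)
      then show ?thesis using f by (simp add: bij_betw_def inv_into_image_cancel)
    qed
    then have "(\<lambda>e. ?g ` e) ` edges H = edges G"
      unfolding E[symmetric] image_image by (simp add: image_def)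
    with G H bij_betw_inv_into[OF f] show "(H, G) \<in> graph_iso"
      by (auto simp: graph_iso_def simp del: prod.collapse)
  qed
  show "trans graph_iso"
  proof (rule transI)
    fix G H K assume "(G, H) \<in> graph_iso" "(H, K) \<in> graph_iso"
    then obtain f g where G: "G \<in> fin_graphs" and K: "K \<in> fin_graphs"
      and f: "bij_betw f (verts G) (verts H)" "(\<lambda>e. f ` e) ` edges G = edges H"
      and g: "bij_betw g (verts H) (verts K)" "(\<lambda>e. g ` e) ` edges H = edges K"
      by (auto simp: graph_iso_def)
    have "(\<lambda>e. (g \<circ> f) ` e) ` edges G = edges K"
      unfolding g(2)[symmetric] f(2)[symmetric] by (simp add: image_comp comp_def image_image)
    with G K bij_betw_trans[OF f(1) g(1)] show "(G, K) \<in> graph_iso"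
      unfolding graph_iso_def by blast
  qed
qed

end

theory Submission
  imports Defs "HOL-Library.Disjoint_Sets"
begin

text \<open>
  For \<open>m \<ge> 4\<close> forbid three graphs: \<open>K\<^sub>m\<close> with an extra vertex joined to two of its vertices,
  two copies of \<open>K\<^sub>m\<close> sharing exactly one vertex, and two disjoint copies of \<open>K\<^sub>m\<close> joined by an
  edge. The \<open>m\<close>-cliques of a graph avoiding them are pairwise disjoint.

  If \<open>m\<close> divides \<open>n\<close>, a disjoint union of copies of \<open>K\<^sub>m\<close> is saturated and has \<open>(m - 1) n / 2\<close>
  edges. Otherwise some vertex of a saturated graph lies in no \<open>m\<close>-clique. Let \<open>r\<close> be one of
  minimal degree \<open>d\<close>. Joining \<open>r\<close> to a vertex \<open>v\<close> whose clique (if any) contains no neighbour of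
  \<open>r\<close> must create a \<open>K\<^sub>m\<close>, so \<open>v\<close> has \<open>m - 2\<close> neighbours inside the neighbourhood of \<open>r\<close>. As at most
  \<open>1 + m d\<close> vertices are not of this kind, the number \<open>e\<close> of edges is at least
  \<open>(m - 2) (n - 1 - m d)\<close>. If \<open>d \<le> m - 2\<close>, this exceeds \<open>(m - 1) n / 2\<close> by a linear term since
  \<open>m \<ge> 4\<close>. If \<open>d \<ge> m - 1\<close>, all degrees are at least \<open>m - 1\<close>, so \<open>2 e \<ge> (m - 1) (n - 1) + d\<close>;
  eliminating \<open>d\<close> from the two bounds again gives a linear excess.
\<close>

section \<open>Graphs and embeddings\<close>

lemma vertex_pairs_mono: "A \<subseteq> B \<Longrightarrow> vertex_pairs A \<subseteq> vertex_pairs B"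
  by (auto simp: vertex_pairs_def)

lemma doubleton_in_vertex_pairs [simp]:
  "{u, v} \<in> vertex_pairs V \<longleftrightarrow> u \<in> V \<and> v \<in> V \<and> u \<noteq> v"
  by (auto simp: vertex_pairs_def card_2_iff doubleton_eq_iff)

lemma vertex_pairsE:
  assumes "e \<in> vertex_pairs V"
  obtains u v where "e = {u, v}" "u \<in> V" "v \<in> V" "u \<noteq> v"
  using assms by (auto simp: vertex_pairs_def card_2_iff)

lemma vertex_pairs_singleton [simp]: "vertex_pairs {x} = {}"
  by (auto elim: vertex_pairsE)

lemma vertex_pairs_Int_disjnt: "disjnt A B \<Longrightarrow> vertex_pairs A \<inter> vertex_pairs B = {}"
  by (fastforce simp: vertex_pairs_def card_2_iff disjnt_iff)

lemma finite_vertex_pairs: "finite V \<Longrightarrow> finite (vertex_pairs V)"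
  by (simp add: vertex_pairs_def)

lemma card_vertex_pairs: "finite V \<Longrightarrow> card (vertex_pairs V) = card V choose 2"
  unfolding vertex_pairs_def by (rule n_subsets)

lemma vertex_pairs_image:
  assumes "inj_on f V"
  shows "vertex_pairs (f ` V) = (`) f ` vertex_pairs V"
proof (intro equalityI subsetI)
  fix e assume "e \<in> vertex_pairs (f ` V)"
  then obtain u v where "e = f ` {u, v}" "{u, v} \<in> vertex_pairs V" by (auto elim!: vertex_pairsE)
  then show "e \<in> (`) f ` vertex_pairs V" by blast
next
  fix e assume "e \<in> (`) f ` vertex_pairs V"
  then show "e \<in> vertex_pairs (f ` V)" using assms by (auto elim!: vertex_pairsE dest: inj_onD)
qed

lemma fin_graphs_doubletonD:
  assumes "G \<in> fin_graphs" "{u, v} \<in> edges G"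
  shows "u \<in> verts G" "v \<in> verts G" "u \<noteq> v"
proof -
  have "{u, v} \<in> vertex_pairs (verts G)" using assms unfolding fin_graphs_def by blast
  then show "u \<in> verts G" "v \<in> verts G" "u \<noteq> v" by simp_all
qed

lemma finite_verts: "G \<in> fin_graphs \<Longrightarrow> finite (verts G)"
  by (simp add: fin_graphs_def)

lemma finite_edges: "G \<in> fin_graphs \<Longrightarrow> finite (edges G)"
  by (auto simp: fin_graphs_def intro: finite_subset finite_vertex_pairs)

definition embedding :: "(nat \<Rightarrow> nat) \<Rightarrow> graph \<Rightarrow> graph \<Rightarrow> bool" where
  "embedding f H G \<longleftrightarrow>
     inj_on f (verts H) \<and> f ` verts H \<subseteq> verts G \<and> (`) f ` edges H \<subseteq> edges G"

lemma graph_iso_image: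
  assumes H: "H \<in> fin_graphs" and f: "inj_on f (verts H)"
  shows "(H, (f ` verts H, (`) f ` edges H)) \<in> graph_iso"
proof -
  have "(`) f ` edges H \<subseteq> vertex_pairs (f ` verts H)"
    using H unfolding vertex_pairs_image[OF f] by (auto simp: fin_graphs_def)
  then have "(f ` verts H, (`) f ` edges H) \<in> fin_graphs"
    using H by (simp add: fin_graphs_def)
  then show ?thesis
    using H inj_on_imp_bij_betw[OF f] by (auto simp: graph_iso_def simp del: prod.collapse)
qed

lemma contains_copy_iff_embedding:
  assumes G: "G \<in> fin_graphs" and H: "H \<in> fin_graphs"
  shows "contains_copy G H \<longleftrightarrow> (\<exists>f. embedding f H G)"
proof
  assume "contains_copy G H"
  then obtain H' where H': "subgraph H' G" "(H, H') \<in> graph_iso"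
    unfolding contains_copy_def by blast
  then obtain f where f: "bij_betw f (verts H) (verts H')" "(`) f ` edges H = edges H'"
    by (auto simp: graph_iso_def)
  then have "embedding f H G"
    using H'(1) by (simp add: embedding_def subgraph_def bij_betw_def)
  then show "\<exists>f. embedding f H G" by blast
next
  assume "\<exists>f. embedding f H G"
  then obtain f where f: "embedding f H G" ..
  let ?H = "(f ` verts H, (`) f ` edges H)"
  have iso: "(H, ?H) \<in> graph_iso" using H f by (intro graph_iso_image) (auto simp: embedding_def)
  moreover have "subgraph ?H G"
    using iso G f by (auto simp: subgraph_def embedding_def graph_iso_def simp del: prod.collapse)
  ultimately show "contains_copy G H" unfolding contains_copy_def by blast
qed

lemma contains_copy_iso:
  assumes "(H, H') \<in> graph_iso" "contains_copy G H'"
  shows "contains_copy G H"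
  using assms equiv_graph_iso unfolding contains_copy_def equiv_def by (meson transD)

lemma graph_iso_refl: "H \<in> fin_graphs \<Longrightarrow> (H, H) \<in> graph_iso"
  using equiv_graph_iso unfolding equiv_def by (blast dest: refl_onD)

lemma contains_member_iso_classes_iff:
  assumes "S \<subseteq> fin_graphs"
  shows "contains_member G ((\<lambda>H. graph_iso `` {H}) ` S) \<longleftrightarrow> (\<exists>H\<in>S. contains_copy G H)"
proof
  assume "contains_member G ((\<lambda>H. graph_iso `` {H}) ` S)"
  then show "\<exists>H\<in>S. contains_copy G H"
    unfolding contains_member_def by (auto intro: contains_copy_iso)
next
  assume "\<exists>H\<in>S. contains_copy G H"
  then show "contains_member G ((\<lambda>H. graph_iso `` {H}) ` S)"
    using assms graph_iso_refl unfolding contains_member_def by blast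
qed

lemma card_verts_eq_if_iso_class_eq:
  assumes "H \<in> fin_graphs" "graph_iso `` {H} = graph_iso `` {H'}"
  shows "card (verts H) = card (verts H')"
proof -
  have "(H', H) \<in> graph_iso" using assms graph_iso_refl by blast
  then show ?thesis by (auto simp: graph_iso_def dest!: bij_betw_same_card)
qed

lemma ex_bij_betw_extending:
  assumes fin: "finite A" "finite B" and card: "card A = card B"
    and p: "S \<subseteq> A" "p ` S \<subseteq> B" "inj_on p S"
  obtains f where "bij_betw f A B" "\<And>x. x \<in> S \<Longrightarrow> f x = p x"
proof -
  have "card (A - S) = card (B - p ` S)"
    using assms by (simp add: card_Diff_subset card_image finite_subset[of _ A])
  then obtain h where h: "bij_betw h (A - S) (B - p ` S)"
    using finite_same_card_bij[of "A - S" "B - p ` S"] fin by blast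
  let ?f = "\<lambda>x. if x \<in> S then p x else h x"
  have "bij_betw ?f (S \<union> (A - S)) (p ` S \<union> (B - p ` S))"
    using inj_on_imp_bij_betw[OF p(3)] h by (rule bij_betw_disjoint_Un) auto
  moreover have "S \<union> (A - S) = A" "p ` S \<union> (B - p ` S) = B" using p by auto
  ultimately have "bij_betw ?f A B" by simp
  then show thesis by (rule that) auto
qed

lemma ex_inj_on_extending_Un:
  assumes fin: "finite A" "finite B" "finite K" "finite L"
    and card: "card A = card K" "card B = card L"
    and S: "S \<subseteq> A \<union> B" "A \<inter> B \<subseteq> S"
    and p: "inj_on p S" "p ` (S \<inter> A) \<subseteq> K" "p ` (S \<inter> B) \<subseteq> L" "K \<inter> L \<subseteq> p ` (A \<inter> B)"
  obtains f where "inj_on f (A \<union> B)" "f ` A = K" "f ` B = L" "\<And>x. x \<in> S \<Longrightarrow> f x = p x"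
proof -
  obtain g where g: "bij_betw g A K" "\<And>x. x \<in> S \<inter> A \<Longrightarrow> g x = p x"
    using ex_bij_betw_extending[of A K "S \<inter> A" p] fin card p by (auto intro: inj_on_subset)
  obtain h where h: "bij_betw h B L" "\<And>x. x \<in> S \<inter> B \<Longrightarrow> h x = p x"
    using ex_bij_betw_extending[of B L "S \<inter> B" p] fin card p by (auto intro: inj_on_subset)
  define f where "f x = (if x \<in> A then g x else h x)" for x
  have f_A: "f x = g x" if "x \<in> A" for x using that by (simp add: f_def)
  have f_B: "f x = h x" if "x \<in> B" for x using that S(2) g(2)[of x] h(2)[of x] by (auto simp: f_def)
  have bij: "bij_betw f A K" "bij_betw f B L"
    using g(1) h(1) bij_betw_cong[of A f g, OF f_A] bij_betw_cong[of B f h, OF f_B] by blast+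
  have separated: "f x \<noteq> f y" if "x \<in> A - B" "y \<in> B - A" for x y
  proof
    assume "f x = f y"
    moreover have "f x \<in> K" "f y \<in> L" using that bij by (auto dest: bij_betwE)
    ultimately have "f y \<in> K \<inter> L" by simp
    then obtain z where z: "z \<in> A \<inter> B" "f y = p z" using p(4) by blast
    then have "f y = f z" using S(2) f_B[of z] h(2)[of z] by auto
    then have "y = z" using that z bij_betw_imp_inj_on[OF bij(2)] by (auto dest: inj_onD)
    then show False using z that by simp
  qed
  show thesis
  proof (rule that)
    show "inj_on f (A \<union> B)"
      unfolding inj_on_Un using bij separated by (auto dest: bij_betw_imp_inj_on)
    show "f ` A = K" "f ` B = L" using bij by (auto simp: bij_betw_def)
    show "f x = p x" if "x \<in> S" for x
      using that S(1) g(2)[of x] h(2)[of x] f_A[of x] f_B[of x] by auto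
  qed
qed

section \<open>The forbidden families\<close>

definition cliques :: "nat \<Rightarrow> graph \<Rightarrow> nat set set" where
  "cliques m G = {K. K \<subseteq> verts G \<and> card K = m \<and> vertex_pairs K \<subseteq> edges G}"

lemma cliquesD:
  assumes "K \<in> cliques m G"
  shows "K \<subseteq> verts G" "card K = m" "\<And>u v. u \<in> K \<Longrightarrow> v \<in> K \<Longrightarrow> u \<noteq> v \<Longrightarrow> {u, v} \<in> edges G"
  using assms by (auto simp: cliques_def)

lemma finite_clique: "G \<in> fin_graphs \<Longrightarrow> K \<in> cliques m G \<Longrightarrow> finite K"
  by (auto dest: finite_verts cliquesD(1) finite_subset)

lemma cliques_1: "cliques 1 G = (\<lambda>x. {x}) ` verts G"
  by (auto simp: cliques_def card_1_singleton_iff)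

lemma image_in_cliques_iff:
  assumes "inj_on f A"
  shows "f ` A \<in> cliques (card A) G \<longleftrightarrow> f ` A \<subseteq> verts G \<and> (`) f ` vertex_pairs A \<subseteq> edges G"
  using assms by (simp add: cliques_def card_image vertex_pairs_image)

definition clique_pair :: "nat set \<Rightarrow> nat set \<Rightarrow> nat set set \<Rightarrow> graph" where
  "clique_pair A B F = (A \<union> B, vertex_pairs A \<union> vertex_pairs B \<union> F)"

lemma clique_pair_in_fin_graphs:
  assumes "finite A" "finite B" "F \<subseteq> vertex_pairs (A \<union> B)"
  shows "clique_pair A B F \<in> fin_graphs"
  using assms vertex_pairs_mono[of A "A \<union> B"] vertex_pairs_mono[of B "A \<union> B"]
  by (simp add: clique_pair_def fin_graphs_def)

lemma embedding_clique_pair_iff: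
  "embedding f (clique_pair A B F) G \<longleftrightarrow> inj_on f (A \<union> B) \<and>
     f ` A \<in> cliques (card A) G \<and> f ` B \<in> cliques (card B) G \<and> (`) f ` F \<subseteq> edges G"
proof (cases "inj_on f (A \<union> B)")
  case True
  then have "inj_on f A" "inj_on f B" by (auto intro: inj_on_subset)
  then show ?thesis
    using True by (auto simp only: embedding_def clique_pair_def fst_conv snd_conv image_Un
        Un_subset_iff image_in_cliques_iff)
qed (simp add: embedding_def clique_pair_def)

lemma ex_embedding_clique_pair:
  assumes G: "G \<in> fin_graphs" and fin: "finite A" "finite B"
    and S: "S \<subseteq> A \<union> B" "A \<inter> B \<subseteq> S" and F: "F \<subseteq> vertex_pairs S"
    and K: "K \<in> cliques (card A) G" and L: "L \<in> cliques (card B) G"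
    and p: "inj_on p S" "p ` (S \<inter> A) \<subseteq> K" "p ` (S \<inter> B) \<subseteq> L" "K \<inter> L \<subseteq> p ` (A \<inter> B)"
    and pF: "(`) p ` F \<subseteq> edges G"
  shows "\<exists>f. embedding f (clique_pair A B F) G"
proof -
  obtain f where f: "inj_on f (A \<union> B)" "f ` A = K" "f ` B = L" "\<And>x. x \<in> S \<Longrightarrow> f x = p x"
    using ex_inj_on_extending_Un[OF fin finite_clique[OF G K] finite_clique[OF G L] _ _ S p]
      cliquesD(2)[OF K] cliquesD(2)[OF L] by metis
  have "f ` e = p ` e" if "e \<in> F" for e
    using that F f(4) by (intro image_cong) (auto simp: vertex_pairs_def)
  then have "(`) f ` F \<subseteq> edges G" using pF by auto
  then have "embedding f (clique_pair A B F) G"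
    unfolding embedding_clique_pair_iff using f(1-3) K L by blast
  then show ?thesis by blast
qed

text \<open>
  Away from \<open>S\<close>, arbitrary bijections onto the two cliques extend \<open>p\<close> to an embedding.
\<close>

lemma contains_clique_pair_iff:
  assumes G: "G \<in> fin_graphs" and fin: "finite A" "finite B"
    and S: "S \<subseteq> A \<union> B" "A \<inter> B \<subseteq> S" and F: "F \<subseteq> vertex_pairs S"
  shows "contains_copy G (clique_pair A B F) \<longleftrightarrow>
    (\<exists>K\<in>cliques (card A) G. \<exists>L\<in>cliques (card B) G. \<exists>p. inj_on p S \<and> p ` (S \<inter> A) \<subseteq> K \<and>
       p ` (S \<inter> B) \<subseteq> L \<and> K \<inter> L = p ` (A \<inter> B) \<and> (`) p ` F \<subseteq> edges G)"
    (is "_ \<longleftrightarrow> ?pattern")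
proof -
  have "clique_pair A B F \<in> fin_graphs"
    using fin F vertex_pairs_mono[OF S(1)] by (intro clique_pair_in_fin_graphs) blast+
  then have "contains_copy G (clique_pair A B F) \<longleftrightarrow> (\<exists>f. embedding f (clique_pair A B F) G)"
    by (rule contains_copy_iff_embedding[OF G])
  also have "\<dots> \<longleftrightarrow> ?pattern"
  proof
    assume "\<exists>f. embedding f (clique_pair A B F) G"
    then obtain f where f: "inj_on f (A \<union> B)" "f ` A \<in> cliques (card A) G"
      "f ` B \<in> cliques (card B) G" "(`) f ` F \<subseteq> edges G"
      unfolding embedding_clique_pair_iff by blast
    moreover have "f ` A \<inter> f ` B = f ` (A \<inter> B)" using f(1) by (simp add: inj_on_image_Int)
    ultimately show ?pattern using inj_on_subset[OF f(1) S(1)] by blast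
  next
    assume ?pattern
    then show "\<exists>f. embedding f (clique_pair A B F) G"
      by (elim bexE exE conjE) (rule ex_embedding_clique_pair[OF G fin S F];
          (assumption | erule equalityD1))
  qed
  finally show ?thesis .
qed

definition clique_ear :: "nat \<Rightarrow> graph" where
  "clique_ear m = clique_pair {..<m} {m} {{0, m}, {1, m}}"

definition clique_bowtie :: "nat \<Rightarrow> graph" where
  "clique_bowtie m = clique_pair {..<m} (insert 0 {m..<2 * m - 1}) {}"

definition clique_dumbbell :: "nat \<Rightarrow> graph" where
  "clique_dumbbell m = clique_pair {..<m} {m..<2 * m} {{0, m}}"

definition forbidden_graphs :: "nat \<Rightarrow> graph set" where
  "forbidden_graphs m = {clique_ear m, clique_bowtie m, clique_dumbbell m}"

definition forbidden_family :: "nat \<Rightarrow> graph set set" where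
  "forbidden_family m = (\<lambda>H. graph_iso `` {H}) ` forbidden_graphs m"

definition has_ear :: "nat \<Rightarrow> graph \<Rightarrow> bool" where
  "has_ear m G \<longleftrightarrow> (\<exists>K\<in>cliques m G. \<exists>a\<in>K. \<exists>b\<in>K. \<exists>x. x \<notin> K \<and> a \<noteq> b \<and>
     {a, x} \<in> edges G \<and> {b, x} \<in> edges G)"

definition has_bowtie :: "nat \<Rightarrow> graph \<Rightarrow> bool" where
  "has_bowtie m G \<longleftrightarrow> (\<exists>K\<in>cliques m G. \<exists>L\<in>cliques m G. card (K \<inter> L) = 1)"

definition has_dumbbell :: "nat \<Rightarrow> graph \<Rightarrow> bool" where
  "has_dumbbell m G \<longleftrightarrow> (\<exists>K\<in>cliques m G. \<exists>L\<in>cliques m G. K \<inter> L = {} \<and>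
     (\<exists>a\<in>K. \<exists>b\<in>L. {a, b} \<in> edges G))"

definition has_forbidden :: "nat \<Rightarrow> graph \<Rightarrow> bool" where
  "has_forbidden m G \<longleftrightarrow> has_ear m G \<or> has_bowtie m G \<or> has_dumbbell m G"

lemma forbidden_graphs_subset_fin_graphs:
  assumes "m \<ge> 2"
  shows "forbidden_graphs m \<subseteq> fin_graphs"
  using assms
  by (simp add: forbidden_graphs_def clique_ear_def clique_bowtie_def clique_dumbbell_def
      clique_pair_in_fin_graphs)

lemma contains_clique_ear_iff:
  assumes G: "G \<in> fin_graphs" and m: "m \<ge> 2"
  shows "contains_copy G (clique_ear m) \<longleftrightarrow> has_ear m G"
proof -
  have S: "{0, 1, m} \<inter> {..<m} = {0, 1}" "{0, 1, m} \<inter> {m} = {m}" "{..<m} \<inter> {m} = {}"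
    using m by auto
  have "contains_copy G (clique_ear m) \<longleftrightarrow>
      (\<exists>K\<in>cliques m G. \<exists>L\<in>cliques 1 G. \<exists>p. inj_on p {0, 1, m} \<and> p ` {0, 1} \<subseteq> K \<and>
        p ` {m} \<subseteq> L \<and> K \<inter> L = {} \<and> (`) p ` {{0, m}, {1, m}} \<subseteq> edges G)"
    (is "_ \<longleftrightarrow> ?pattern")
    unfolding clique_ear_def using m
    by (subst contains_clique_pair_iff[OF G, where S = "{0, 1, m}"]) (auto simp: S)
  also have "?pattern \<longleftrightarrow> has_ear m G"
  proof
    assume ?pattern
    then obtain K p where "K \<in> cliques m G" "p 0 \<in> K" "p 1 \<in> K" "p m \<notin> K" "p 0 \<noteq> p 1"
      "{p 0, p m} \<in> edges G" "{p 1, p m} \<in> edges G"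
      by (auto simp: inj_on_def)
    then show "has_ear m G" unfolding has_ear_def by blast
  next
    assume "has_ear m G"
    then obtain K a b x where K: "K \<in> cliques m G" "a \<in> K" "b \<in> K" "x \<notin> K" "a \<noteq> b"
      and ax: "{a, x} \<in> edges G" and bx: "{b, x} \<in> edges G"
      unfolding has_ear_def by blast
    have "{x} \<in> cliques 1 G" using fin_graphs_doubletonD[OF G ax] unfolding cliques_1 by blast
    moreover have "K \<inter> {x} = {}" using K(4) by blast
    moreover obtain p :: "nat \<Rightarrow> nat" where "p 0 = a" "p 1 = b" "p m = x"
      using m that[of "(\<lambda>_. x)(0 := a, 1 := b)"] by auto
    moreover from this have "inj_on p {0, 1, m}" using K by (auto simp: inj_on_def)
    ultimately show ?pattern
      using K(1-3) ax bx by (intro bexI[of _ K] bexI[of _ "{x}"] exI[of _ p]) auto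
  qed
  finally show ?thesis .
qed

lemma contains_clique_bowtie_iff:
  assumes G: "G \<in> fin_graphs" and m: "m \<ge> 2"
  shows "contains_copy G (clique_bowtie m) \<longleftrightarrow> has_bowtie m G"
proof -
  define B where "B = insert 0 {m..<2 * m - 1}"
  have B: "finite B" "0 \<in> B" "{..<m} \<inter> B = {0}" "card B = m"
    using m by (auto simp: B_def card_insert_if)
  have meet_in_one: "(\<exists>p. p (0 :: nat) \<in> K \<and> p 0 \<in> L \<and> K \<inter> L = {p 0}) \<longleftrightarrow> card (K \<inter> L) = 1"
    for K L :: "nat set"
  proof
    assume "card (K \<inter> L) = 1"
    then obtain c where "K \<inter> L = {c}" by (rule card_1_singletonE)
    then show "\<exists>p. p (0 :: nat) \<in> K \<and> p 0 \<in> L \<and> K \<inter> L = {p 0}"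
      by (intro exI[of _ "\<lambda>_. c"]) auto
  qed auto
  show ?thesis
    unfolding clique_bowtie_def B_def[symmetric] has_bowtie_def meet_in_one[symmetric]
    using m B by (subst contains_clique_pair_iff[OF G, where S = "{0}"]) simp_all
qed

lemma contains_clique_dumbbell_iff:
  assumes G: "G \<in> fin_graphs" and m: "m \<ge> 2"
  shows "contains_copy G (clique_dumbbell m) \<longleftrightarrow> has_dumbbell m G"
proof -
  have S: "{0, m} \<inter> {..<m} = {0}" "{0, m} \<inter> {m..<2 * m} = {m}" "{..<m} \<inter> {m..<2 * m} = {}"
    using m by auto
  have "contains_copy G (clique_dumbbell m) \<longleftrightarrow>
      (\<exists>K\<in>cliques m G. \<exists>L\<in>cliques m G. \<exists>p. inj_on p {0, m} \<and> p 0 \<in> K \<and> p m \<in> L \<and>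
        K \<inter> L = {} \<and> {p 0, p m} \<in> edges G)"
    (is "_ \<longleftrightarrow> ?pattern")
    unfolding clique_dumbbell_def using m
    by (subst contains_clique_pair_iff[OF G, where S = "{0, m}"]) (auto simp: S)
  also have "?pattern \<longleftrightarrow> has_dumbbell m G"
  proof
    assume "has_dumbbell m G"
    then obtain K L a b where KL: "K \<in> cliques m G" "L \<in> cliques m G" "K \<inter> L = {}"
      and ab: "a \<in> K" "b \<in> L" "{a, b} \<in> edges G"
      unfolding has_dumbbell_def by blast
    moreover obtain p :: "nat \<Rightarrow> nat" where "p 0 = a" "p m = b"
      using m that[of "(\<lambda>_. b)(0 := a)"] by auto
    moreover from this have "inj_on p {0, m}" using KL ab by (auto simp: inj_on_def)
    ultimately show ?pattern by blast
  qed (auto simp: has_dumbbell_def)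
  finally show ?thesis .
qed

lemma contains_forbidden_family_iff:
  assumes "G \<in> fin_graphs" "m \<ge> 2"
  shows "contains_member G (forbidden_family m) \<longleftrightarrow> has_forbidden m G"
  unfolding forbidden_family_def
    contains_member_iso_classes_iff[OF forbidden_graphs_subset_fin_graphs[OF assms(2)]]
  by (simp add: assms forbidden_graphs_def has_forbidden_def contains_clique_ear_iff
      contains_clique_bowtie_iff contains_clique_dumbbell_iff)

lemma forbidden_family_subset_iso_classes: "m \<ge> 2 \<Longrightarrow> forbidden_family m \<subseteq> iso_classes"
  using forbidden_graphs_subset_fin_graphs[of m]
  by (auto simp: forbidden_family_def iso_classes_def intro!: quotientI simp del: prod.collapse)

lemma card_verts_forbidden_graphs:
  assumes "m \<ge> 1"
  shows "card (verts (clique_ear m)) = m + 1" "card (verts (clique_bowtie m)) = 2 * m - 1"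
    "card (verts (clique_dumbbell m)) = 2 * m"
proof -
  have "{..<m} \<union> {m} = {..m}" "{..<m} \<union> insert 0 {m..<2 * m - 1} = {..<2 * m - 1}"
    "{..<m} \<union> {m..<2 * m} = {..<2 * m}"
    using assms by auto
  then show "card (verts (clique_ear m)) = m + 1" "card (verts (clique_bowtie m)) = 2 * m - 1"
    "card (verts (clique_dumbbell m)) = 2 * m"
    by (simp_all add: clique_ear_def clique_bowtie_def clique_dumbbell_def clique_pair_def)
qed

lemma card_forbidden_family:
  assumes "m \<ge> 3"
  shows "card (forbidden_family m) = 3"
proof -
  have "clique_ear m \<in> fin_graphs" "clique_bowtie m \<in> fin_graphs"
    using assms forbidden_graphs_subset_fin_graphs[of m] by (auto simp: forbidden_graphs_def)
  then have "graph_iso `` {clique_ear m} \<noteq> graph_iso `` {clique_bowtie m}"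
    "graph_iso `` {clique_ear m} \<noteq> graph_iso `` {clique_dumbbell m}"
    "graph_iso `` {clique_bowtie m} \<noteq> graph_iso `` {clique_dumbbell m}"
    using assms
      card_verts_eq_if_iso_class_eq[of "clique_ear m" "clique_bowtie m"]
      card_verts_eq_if_iso_class_eq[of "clique_ear m" "clique_dumbbell m"]
      card_verts_eq_if_iso_class_eq[of "clique_bowtie m" "clique_dumbbell m"]
    unfolding card_verts_forbidden_graphs[OF order.trans[OF _ assms], simplified] by linarith+
  then show ?thesis by (simp add: forbidden_family_def forbidden_graphs_def)
qed

lemma inj_on_forbidden_family: "inj_on forbidden_family {2..}"
proof -
  have "m \<le> m'" if m: "m \<ge> 2" "m' \<ge> 2" and eq: "forbidden_family m = forbidden_family m'" for m m'
  proof -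
    have "clique_dumbbell m \<in> fin_graphs"
      using m forbidden_graphs_subset_fin_graphs[of m] by (auto simp: forbidden_graphs_def)
    moreover have "graph_iso `` {clique_dumbbell m} \<in> forbidden_family m'"
      unfolding eq[symmetric] by (simp add: forbidden_family_def forbidden_graphs_def)
    ultimately obtain H where "H \<in> forbidden_graphs m'"
      "card (verts (clique_dumbbell m)) = card (verts H)"
      unfolding forbidden_family_def by (auto dest: card_verts_eq_if_iso_class_eq)
    then show ?thesis using m by (auto simp: forbidden_graphs_def card_verts_forbidden_graphs)
  qed
  then show ?thesis by (intro inj_onI antisym) auto
qed

lemma saturated_forbidden_family_iff:
  assumes "m \<ge> 2"
  shows "saturated (forbidden_family m) G \<longleftrightarrow> G \<in> fin_graphs \<and> \<not> has_forbidden m G \<and>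
    (\<forall>u\<in>verts G. \<forall>v\<in>verts G. u \<noteq> v \<longrightarrow> {u, v} \<notin> edges G \<longrightarrow> has_forbidden m (add_edge {u, v} G))"
proof (cases "G \<in> fin_graphs")
  case True
  have "contains_member (add_edge {u, v} G) (forbidden_family m) \<longleftrightarrow>
      has_forbidden m (add_edge {u, v} G)"
    if "u \<in> verts G" "v \<in> verts G" "u \<noteq> v" for u v
    using that True assms
    by (intro contains_forbidden_family_iff) (auto simp: add_edge_def fin_graphs_def)
  moreover have "(\<forall>e\<in>vertex_pairs (verts G) - edges G. P e) \<longleftrightarrow>
      (\<forall>u\<in>verts G. \<forall>v\<in>verts G. u \<noteq> v \<longrightarrow> {u, v} \<notin> edges G \<longrightarrow> P {u, v})" for P
    by (auto elim!: vertex_pairsE)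
  ultimately show ?thesis
    unfolding saturated_def contains_forbidden_family_iff[OF True assms] by simp
qed (simp add: saturated_def)

section \<open>Existence of saturated graphs\<close>

lemma ex_saturated_supergraph:
  assumes G: "G \<in> fin_graphs" and free: "\<not> contains_member G \<F>"
  obtains G' where "saturated \<F> G'" "verts G' = verts G" "edges G \<subseteq> edges G'"
proof -
  define \<E> where "\<E> = {E. E \<subseteq> vertex_pairs (verts G) \<and> \<not> contains_member (verts G, E) \<F>}"
  have "finite \<E>"
    using finite_vertex_pairs[OF finite_verts[OF G]] by (auto simp: \<E>_def)
  moreover have "edges G \<in> \<E>" using G free by (simp add: \<E>_def fin_graphs_def)
  ultimately obtain E where E: "E \<in> \<E>" "edges G \<subseteq> E"
    and max: "\<And>E'. E' \<in> \<E> \<Longrightarrow> E \<subseteq> E' \<Longrightarrow> E = E'"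
    using finite_has_maximal2 by metis
  have "saturated \<F> (verts G, E)"
    unfolding saturated_def
  proof (intro conjI ballI)
    show "(verts G, E) \<in> fin_graphs" "\<not> contains_member (verts G, E) \<F>"
      using E(1) finite_verts[OF G] by (auto simp: fin_graphs_def \<E>_def)
    fix e assume "e \<in> vertex_pairs (verts (verts G, E)) - edges (verts G, E)"
    then show "contains_member (add_edge e (verts G, E)) \<F>"
      using E(1) max[of "insert e E"] by (auto simp: add_edge_def \<E>_def)
  qed
  then show thesis using that E(2) by simp
qed

lemma sat_le:
  assumes "saturated \<F> G"
  shows "sat (card (verts G)) \<F> \<le> card (edges G)"
  unfolding sat_def using assms by (intro cInf_lower) blast+

lemma sat_attained:
  assumes "\<not> contains_member ({..<n}, {}) \<F>"
  obtains G where "saturated \<F> G" "card (verts G) = n" "card (edges G) = sat n \<F>"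
proof -
  have "({..<n}, {}) \<in> fin_graphs" by (simp add: fin_graphs_def)
  then obtain G where "saturated \<F> G" "verts G = {..<n}"
    using assms ex_saturated_supergraph[of "({..<n}, {})"] by auto
  moreover from this have "card (verts G) = n" by simp
  ultimately have "card (edges G) \<in> {card (edges G) | G. saturated \<F> G \<and> card (verts G) = n}"
    by blast
  then have "sat n \<F> \<in> {card (edges G) | G. saturated \<F> G \<and> card (verts G) = n}"
    unfolding sat_def by (intro Inf_nat_def1) blast
  then obtain G where "saturated \<F> G" "card (verts G) = n" "sat n \<F> = card (edges G)" by blast
  then show thesis using that by simp
qed

lemma cliques_edgeless:
  assumes "m \<ge> 2"
  shows "cliques m (V, {}) = {}"
proof -
  have "vertex_pairs K \<noteq> {}" if "card K = m" for K
  proof -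
    have "finite K" using that assms by (auto intro: card_ge_0_finite)
    then have "card (vertex_pairs K) > 0" using that assms by (simp add: card_vertex_pairs)
    then show ?thesis by auto
  qed
  then show ?thesis by (auto simp: cliques_def)
qed

lemma sat_forbidden_family_attained:
  assumes "m \<ge> 2"
  obtains G where "saturated (forbidden_family m) G" "card (verts G) = n"
    "card (edges G) = sat n (forbidden_family m)"
proof (rule sat_attained)
  have "({..<n}, {}) \<in> fin_graphs" by (simp add: fin_graphs_def)
  then show "\<not> contains_member ({..<n}, {}) (forbidden_family m)"
    using assms by (simp add: contains_forbidden_family_iff has_forbidden_def has_ear_def
        has_bowtie_def has_dumbbell_def cliques_edgeless)
qed

section \<open>Disjoint unions of cliques\<close>

definition clique_union :: "nat set set \<Rightarrow> graph" where
  "clique_union P = (\<Union>P, \<Union>(vertex_pairs ` P))"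

lemma clique_union_in_fin_graphs:
  assumes "finite P" "\<And>K. K \<in> P \<Longrightarrow> finite K"
  shows "clique_union P \<in> fin_graphs"
  using assms vertex_pairs_mono[of _ "\<Union>P"] by (auto simp: clique_union_def fin_graphs_def)

lemma edges_clique_union_iff:
  "{u, v} \<in> edges (clique_union P) \<longleftrightarrow> u \<noteq> v \<and> (\<exists>K\<in>P. u \<in> K \<and> v \<in> K)"
  by (auto simp: clique_union_def)

lemma card_edges_clique_union:
  assumes "finite P" "disjoint P" "\<And>K. K \<in> P \<Longrightarrow> card K = m" "m > 0"
  shows "card (edges (clique_union P)) = card P * (m choose 2)"
proof -
  have fin: "finite K" if "K \<in> P" for K using that assms by (auto intro: card_ge_0_finite)
  then have "card (\<Union>K\<in>P. vertex_pairs K) = (\<Sum>K\<in>P. card (vertex_pairs K))"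
    using assms by (intro card_UN_disjoint)
      (auto simp: finite_vertex_pairs pairwise_def intro!: vertex_pairs_Int_disjnt)
  also have "\<dots> = card P * (m choose 2)" using fin assms by (simp add: card_vertex_pairs)
  finally show ?thesis by (simp add: clique_union_def)
qed

lemma cliques_clique_union:
  assumes disj: "disjoint P" and card: "\<And>K. K \<in> P \<Longrightarrow> card K = m" and m: "m > 0"
  shows "cliques m (clique_union P) = P"
proof (intro equalityI subsetI)
  fix K assume K: "K \<in> cliques m (clique_union P)"
  then obtain u where u: "u \<in> K" using m by (fastforce simp: cliques_def)
  then obtain L where L: "L \<in> P" "u \<in> L"
    using cliquesD(1)[OF K] by (auto simp: clique_union_def)
  have "v \<in> L" if v: "v \<in> K" for v
  proof (cases "u = v")
    case False
    then obtain M where "M \<in> P" "u \<in> M" "v \<in> M"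
      using cliquesD(3)[OF K u v] by (auto simp: edges_clique_union_iff)
    then show ?thesis using disjointD[OF disj] L by blast
  qed (use L in simp)
  then have "K \<subseteq> L" by blast
  moreover have "finite L" using card[OF L(1)] m by (simp add: card_ge_0_finite)
  ultimately show "K \<in> P" using L card cliquesD(2)[OF K] card_subset_eq by metis
qed (auto simp: cliques_def clique_union_def card)

lemma not_forbidden_clique_union:
  assumes disj: "disjoint P" and card: "\<And>K. K \<in> P \<Longrightarrow> card K = m" and m: "m \<ge> 2"
  shows "\<not> has_forbidden m (clique_union P)"
proof -
  have cliques: "cliques m (clique_union P) = P"
    using m by (intro cliques_clique_union disj card) auto
  have closed: "v \<in> K" if "K \<in> P" "u \<in> K" "{u, v} \<in> edges (clique_union P)" for K u v
    using that disjointD[OF disj] by (fastforce simp: edges_clique_union_iff)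
  have "\<not> has_ear m (clique_union P)" "\<not> has_dumbbell m (clique_union P)"
    using closed unfolding has_ear_def has_dumbbell_def cliques by blast+
  moreover have "card (K \<inter> L) \<noteq> 1" if "K \<in> P" "L \<in> P" for K L
    using that disjointD[OF disj] card m by (cases "K = L") auto
  then have "\<not> has_bowtie m (clique_union P)" unfolding has_bowtie_def cliques by blast
  ultimately show ?thesis by (simp add: has_forbidden_def)
qed

lemma cliques_mono: "verts G \<subseteq> verts G' \<Longrightarrow> edges G \<subseteq> edges G' \<Longrightarrow> cliques m G \<subseteq> cliques m G'"
  by (auto simp: cliques_def)

lemma saturated_clique_union:
  assumes fin: "finite P" and disj: "disjoint P"
    and card: "\<And>K. K \<in> P \<Longrightarrow> card K = m" and m: "m \<ge> 2"
  shows "saturated (forbidden_family m) (clique_union P)"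
  unfolding saturated_forbidden_family_iff[OF m]
proof (intro conjI ballI impI)
  have "finite K" if "K \<in> P" for K using that card m by (fastforce intro: card_ge_0_finite)
  then show "clique_union P \<in> fin_graphs" using fin by (intro clique_union_in_fin_graphs)
  show "\<not> has_forbidden m (clique_union P)" using disj card m by (rule not_forbidden_clique_union)
  fix u v
  let ?G = "add_edge {u, v} (clique_union P)"
  assume "u \<in> verts (clique_union P)" "v \<in> verts (clique_union P)"
    and new: "u \<noteq> v" "{u, v} \<notin> edges (clique_union P)"
  then obtain K L where K: "K \<in> P" "u \<in> K" and L: "L \<in> P" "v \<in> L"
    by (auto simp: clique_union_def)
  have "K \<noteq> L" using K L new by (auto simp: edges_clique_union_iff)
  then have "K \<inter> L = {}" using disjointD[OF disj] K L by blast
  moreover have "P \<subseteq> cliques m ?G"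
    using cliques_clique_union[OF disj card] m cliques_mono[of "clique_union P" ?G m]
    by (auto simp: add_edge_def)
  moreover have "{u, v} \<in> edges ?G" by (simp add: add_edge_def)
  ultimately have "has_dumbbell m ?G" using K L unfolding has_dumbbell_def by blast
  then show "has_forbidden m ?G" by (simp add: has_forbidden_def)
qed

lemma ex_disjoint_sets_of_card:
  assumes "m > 0"
  obtains P :: "nat set set" where "finite P" "card P = t" "disjoint P" "\<And>K. K \<in> P \<Longrightarrow> card K = m"
proof -
  define B where "B i = {i * m..<Suc i * m}" for i
  have "B i \<inter> B j = {}" if "i < j" for i j
  proof -
    have "Suc i * m \<le> j * m" using that by (intro mult_le_mono1) simp
    then show ?thesis by (auto simp: B_def)
  qed
  then have disj: "B i \<inter> B j = {}" if "i \<noteq> j" for i j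
    using that by (metis Int_commute linorder_neqE_nat)
  have card_B: "card (B i) = m" for i by (simp add: B_def)
  have "inj_on B {..<t}"
    using disj card_B assms by (metis Int_absorb card.empty inj_onI less_irrefl)
  then have "card (B ` {..<t}) = t" by (simp add: card_image)
  moreover have "disjoint (B ` {..<t})" using disj by (intro disjointI) (metis imageE)
  ultimately show thesis using card_B by (intro that[of "B ` {..<t}"]) auto
qed

lemma sat_forbidden_family_multiple_le:
  assumes "m \<ge> 2"
  shows "sat (m * t) (forbidden_family m) \<le> t * (m choose 2)"
proof -
  obtain P :: "nat set set" where P: "finite P" "card P = t" "disjoint P"
    and card: "\<And>K. K \<in> P \<Longrightarrow> card K = m"
    using ex_disjoint_sets_of_card[of m t] assms by auto
  have "card (verts (clique_union P)) = sum card P"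
    unfolding clique_union_def fst_conv
    using P(3) card assms by (intro card_Union_disjoint) (fastforce intro: card_ge_0_finite)+
  then have "card (verts (clique_union P)) = m * t" using P(2) card by simp
  then show ?thesis
    using sat_le[OF saturated_clique_union[OF P(1,3) card assms]]
      card_edges_clique_union[OF P(1,3) card] assms P(2) by simp
qed

section \<open>Edges of saturated graphs with an uncovered vertex\<close>

definition nbrs :: "graph \<Rightarrow> nat \<Rightarrow> nat set" where
  "nbrs G v = {u. {v, u} \<in> edges G}"

abbreviation degree :: "graph \<Rightarrow> nat \<Rightarrow> nat" where
  "degree G v \<equiv> card (nbrs G v)"

lemma finite_nbrs:
  assumes "G \<in> fin_graphs"
  shows "finite (nbrs G v)"
proof (rule finite_subset)
  show "nbrs G v \<subseteq> verts G" using assms by (auto simp: nbrs_def dest: fin_graphs_doubletonD)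
qed (rule finite_verts[OF assms])

lemma degree_eq_card_incident_edges:
  assumes "G \<in> fin_graphs"
  shows "degree G v = card {e \<in> edges G. v \<in> e}"
proof -
  have "e \<in> (\<lambda>u. {v, u}) ` nbrs G v" if e: "e \<in> edges G" "v \<in> e" for e
  proof -
    have "e \<in> vertex_pairs (verts G)" using e(1) assms by (auto simp: fin_graphs_def)
    then show ?thesis using e by (auto simp: nbrs_def insert_commute elim!: vertex_pairsE)
  qed
  then have "(\<lambda>u. {v, u}) ` nbrs G v = {e \<in> edges G. v \<in> e}" by (auto simp: nbrs_def)
  moreover have "inj_on (\<lambda>u. {v, u}) (nbrs G v)" by (auto simp: inj_on_def doubleton_eq_iff)
  ultimately show ?thesis by (metis card_image)
qed

lemma sum_degree:
  assumes G: "G \<in> fin_graphs"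
  shows "(\<Sum>v\<in>verts G. degree G v) = 2 * card (edges G)"
proof -
  have "card {v \<in> verts G. v \<in> e} = 2" if "e \<in> edges G" for e
  proof -
    have "{v \<in> verts G. v \<in> e} = e" "card e = 2"
      using that G by (auto simp: fin_graphs_def vertex_pairs_def)
    then show ?thesis by simp
  qed
  then show ?thesis
    unfolding degree_eq_card_incident_edges[OF G]
    using finite_verts[OF G] finite_edges[OF G] by (intro sum_multicount) auto
qed

lemma twice_card_edges_ge:
  assumes G: "G \<in> fin_graphs" and r: "r \<in> verts G"
    and min_degree: "\<And>v. v \<in> verts G \<Longrightarrow> k \<le> degree G v"
  shows "k * (card (verts G) - 1) + degree G r \<le> 2 * card (edges G)"
proof -
  have "k * (card (verts G) - 1) = (\<Sum>v\<in>verts G - {r}. k)" using r by simp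
  also have "\<dots> \<le> (\<Sum>v\<in>verts G - {r}. degree G v)" using min_degree by (intro sum_mono) auto
  finally show ?thesis
    unfolding sum_degree[OF G, symmetric] sum.remove[OF finite_verts[OF G] r] by simp
qed

lemma card_edges_ge_of_cross_degrees:
  assumes G: "G \<in> fin_graphs" and UN: "U \<subseteq> verts G" "U \<inter> N = {}"
    and cross: "\<And>v. v \<in> U \<Longrightarrow> k \<le> card (nbrs G v \<inter> N)"
  shows "k * card U \<le> card (edges G)"
proof -
  let ?cross = "SIGMA v:U. nbrs G v \<inter> N"
  have "finite U" using UN(1) finite_verts[OF G] by (rule finite_subset)
  have "k * card U = (\<Sum>v\<in>U. k)" by simp
  also have "\<dots> \<le> (\<Sum>v\<in>U. card (nbrs G v \<inter> N))" using cross by (rule sum_mono)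
  also have "\<dots> = card ?cross"
    using \<open>finite U\<close> finite_nbrs[OF G] by (simp add: card_SigmaI)
  also have "\<dots> \<le> card (edges G)"
  proof (rule card_inj_on_le)
    show "inj_on (\<lambda>(v, x). {v, x}) ?cross"
      using UN(2) by (auto simp: inj_on_def doubleton_eq_iff)
    show "(\<lambda>(v, x). {v, x}) ` ?cross \<subseteq> edges G" by (auto simp: nbrs_def)
  qed (rule finite_edges[OF G])
  finally show ?thesis .
qed

lemma clique_degree_ge:
  assumes "G \<in> fin_graphs" "K \<in> cliques m G" "v \<in> K"
  shows "m - 1 \<le> degree G v"
proof -
  have "K - {v} \<subseteq> nbrs G v" using assms cliquesD(3)[OF assms(2)] by (auto simp: nbrs_def)
  then have "card (K - {v}) \<le> degree G v" using finite_nbrs[OF assms(1)] by (intro card_mono)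
  then show ?thesis using assms(3) cliquesD(2)[OF assms(2)] by simp
qed

lemma disjoint_cliques:
  assumes G: "G \<in> fin_graphs" and free: "\<not> has_forbidden m G"
  shows "disjoint (cliques m G)"
proof (rule disjointI, rule ccontr)
  fix K L assume K: "K \<in> cliques m G" and L: "L \<in> cliques m G" and "K \<noteq> L" "K \<inter> L \<noteq> {}"
  have fin: "finite K" "finite L" using finite_clique G K L by auto
  have "card (K \<inter> L) \<noteq> 1" using free K L by (auto simp: has_forbidden_def has_bowtie_def)
  moreover have "card (K \<inter> L) \<noteq> 0" using \<open>K \<inter> L \<noteq> {}\<close> fin by simp
  ultimately have "2 \<le> card (K \<inter> L)" by linarith
  then obtain T where "T \<subseteq> K \<inter> L" "card T = 2" by (meson obtain_subset_with_card_n)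
  then obtain a b where ab: "a \<in> K" "a \<in> L" "b \<in> K" "b \<in> L" "a \<noteq> b"
    by (auto simp: card_2_iff)
  have "\<not> L \<subseteq> K" using \<open>K \<noteq> L\<close> fin cliquesD(2)[OF K] cliquesD(2)[OF L] card_subset_eq by metis
  then obtain x where x: "x \<in> L" "x \<notin> K" by blast
  then have "{a, x} \<in> edges G" "{b, x} \<in> edges G" using ab cliquesD(3)[OF L] by metis+
  then have "has_ear m G" using K ab x unfolding has_ear_def by blast
  then show False using free by (simp add: has_forbidden_def)
qed

definition uncovered :: "nat \<Rightarrow> graph \<Rightarrow> nat set" where
  "uncovered m G = verts G - \<Union>(cliques m G)"

lemma uncovered_nonempty:
  assumes G: "G \<in> fin_graphs" and free: "\<not> has_forbidden m G" and ndvd: "\<not> m dvd card (verts G)"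
  shows "uncovered m G \<noteq> {}"
proof
  assume "uncovered m G = {}"
  then have "verts G = \<Union>(cliques m G)" by (auto simp: uncovered_def dest: cliquesD(1))
  then have "card (verts G) = sum card (cliques m G)"
    using disjoint_cliques[OF G free] finite_clique[OF G] by (simp add: card_Union_disjoint)
  also have "\<dots> = m * card (cliques m G)" by (simp add: cliquesD(2))
  finally show False using ndvd by simp
qed

lemma cliques_add_edgeD:
  assumes "K \<in> cliques m (add_edge e G)" "\<not> e \<subseteq> K"
  shows "K \<in> cliques m G"
  using assms by (auto simp: cliques_def add_edge_def vertex_pairs_def)

lemma edges_add_edgeD:
  assumes "{a, b} \<in> edges (add_edge {r, v} G)" "a \<noteq> r"
  shows "{a, b} \<in> edges G \<or> a = v \<and> b = r"
  using assms by (auto simp: add_edge_def doubleton_eq_iff)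

lemma uncovered_notin_clique: "r \<in> uncovered m G \<Longrightarrow> K \<in> cliques m G \<Longrightarrow> r \<notin> K"
  by (auto simp: uncovered_def)

lemma has_ear_add_edgeD:
  assumes ear: "has_ear m (add_edge {r, v} G)"
    and old: "cliques m (add_edge {r, v} G) \<subseteq> cliques m G" and r: "r \<in> uncovered m G"
    and far: "\<And>K. K \<in> cliques m G \<Longrightarrow> v \<in> K \<Longrightarrow> K \<inter> nbrs G r = {}"
  shows "has_ear m G"
proof -
  let ?G = "add_edge {r, v} G"
  obtain K a b x where K: "K \<in> cliques m G" "a \<in> K" "b \<in> K" "x \<notin> K" "a \<noteq> b"
    and x: "{a, x} \<in> edges ?G" "{b, x} \<in> edges ?G"
    using ear old unfolding has_ear_def by blast
  have old_edge: "{a, x} \<in> edges G"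
    if ab: "a \<in> K" "b \<in> K" "a \<noteq> b" and x: "{a, x} \<in> edges ?G" "{b, x} \<in> edges ?G" for a b
  proof (rule ccontr)
    assume "{a, x} \<notin> edges G"
    moreover have "a \<noteq> r" "b \<noteq> r" using ab uncovered_notin_clique[OF r K(1)] by auto
    ultimately have "a = v" "x = r" "{b, r} \<in> edges G"
      using ab(3) edges_add_edgeD[OF x(1)] edges_add_edgeD[OF x(2)] by auto
    then have "b \<in> K \<inter> nbrs G r" using ab(2) by (simp add: nbrs_def insert_commute)
    then show False using far[OF K(1)] ab(1) \<open>a = v\<close> by blast
  qed
  have "{a, x} \<in> edges G" "{b, x} \<in> edges G"
    using old_edge[OF K(2,3,5) x] old_edge[OF K(3,2) K(5)[symmetric] x(2,1)] .
  then show ?thesis using K unfolding has_ear_def by blast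
qed

lemma has_dumbbell_add_edgeD:
  assumes dumbbell: "has_dumbbell m (add_edge {r, v} G)"
    and old: "cliques m (add_edge {r, v} G) \<subseteq> cliques m G" and r: "r \<in> uncovered m G"
  shows "has_dumbbell m G"
proof -
  obtain K L a b where KL: "K \<in> cliques m G" "L \<in> cliques m G" "K \<inter> L = {}"
    and ab: "a \<in> K" "b \<in> L" "{a, b} \<in> edges (add_edge {r, v} G)"
    using dumbbell old unfolding has_dumbbell_def by blast
  have "a \<noteq> r" "b \<noteq> r" using ab KL uncovered_notin_clique[OF r] by auto
  then have "{a, b} \<in> edges G" using edges_add_edgeD[OF ab(3)] by blast
  then show ?thesis using KL ab(1,2) unfolding has_dumbbell_def by blast
qed

lemma ex_clique_through_added_edge:
  assumes free: "\<not> has_forbidden m G" and forb: "has_forbidden m (add_edge {r, v} G)"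
    and r: "r \<in> uncovered m G"
    and far: "\<And>K. K \<in> cliques m G \<Longrightarrow> v \<in> K \<Longrightarrow> K \<inter> nbrs G r = {}"
  obtains K where "K \<in> cliques m (add_edge {r, v} G)" "r \<in> K" "v \<in> K"
proof (rule ccontr)
  assume "\<not> thesis"
  then have old: "cliques m (add_edge {r, v} G) \<subseteq> cliques m G"
    using that cliques_add_edgeD[of _ m "{r, v}" G] by auto
  have "\<not> has_bowtie m (add_edge {r, v} G)"
    using free old unfolding has_forbidden_def has_bowtie_def by blast
  moreover have "\<not> has_ear m (add_edge {r, v} G)"
    using free has_ear_add_edgeD[OF _ old r far] by (auto simp: has_forbidden_def)
  moreover have "\<not> has_dumbbell m (add_edge {r, v} G)"
    using free has_dumbbell_add_edgeD[OF _ old r] by (auto simp: has_forbidden_def)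
  ultimately show False using forb by (simp add: has_forbidden_def)
qed

lemma card_common_nbrs_ge:
  assumes G: "G \<in> fin_graphs" and K: "K \<in> cliques m (add_edge {r, v} G)" "r \<in> K" "v \<in> K" "r \<noteq> v"
  shows "m - 2 \<le> card (nbrs G v \<inter> nbrs G r)"
proof -
  have "K - {r, v} \<subseteq> nbrs G v \<inter> nbrs G r"
  proof
    fix x assume x: "x \<in> K - {r, v}"
    then have "{v, x} \<in> edges (add_edge {r, v} G)" "{r, x} \<in> edges (add_edge {r, v} G)"
      using K cliquesD(3)[OF K(1)] by auto
    then show "x \<in> nbrs G v \<inter> nbrs G r"
      using x by (auto simp: add_edge_def nbrs_def doubleton_eq_iff)
  qed
  then have "card (K - {r, v}) \<le> card (nbrs G v \<inter> nbrs G r)"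
    using finite_nbrs[OF G] by (intro card_mono) auto
  moreover have "card (K - {r, v}) = m - 2"
    using K cliquesD(2)[OF K(1)] by (simp add: card_Diff_subset)
  ultimately show ?thesis by simp
qed

definition clique_hull :: "nat \<Rightarrow> graph \<Rightarrow> nat set \<Rightarrow> nat set" where
  "clique_hull m G X = X \<union> \<Union>{K \<in> cliques m G. K \<inter> X \<noteq> {}}"

lemma card_clique_hull_le:
  assumes G: "G \<in> fin_graphs" and disj: "disjoint (cliques m G)" and m: "m \<ge> 1" and X: "finite X"
  shows "finite (clique_hull m G X)" "card (clique_hull m G X) \<le> m * card X"
proof -
  have hull_eq: "clique_hull m G X = (\<Union>x\<in>X. clique_hull m G {x})"
    by (auto simp: clique_hull_def)
  have single: "finite (clique_hull m G {x})" "card (clique_hull m G {x}) \<le> m" for x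
  proof -
    consider "clique_hull m G {x} = {x}" | K where "K \<in> cliques m G" "clique_hull m G {x} = K"
    proof (cases "\<exists>K\<in>cliques m G. x \<in> K")
      case True
      then obtain K where K: "K \<in> cliques m G" "x \<in> K" by blast
      then have "{L \<in> cliques m G. L \<inter> {x} \<noteq> {}} = {K}" using disjointD[OF disj] by blast
      then show ?thesis using K that(2) by (auto simp: clique_hull_def)
    qed (use that(1) in \<open>auto simp: clique_hull_def\<close>)
    then show "finite (clique_hull m G {x})" "card (clique_hull m G {x}) \<le> m"
      using m finite_clique[OF G] cliquesD(2) by (cases, auto)+
  qed
  show "finite (clique_hull m G X)" unfolding hull_eq using X single(1) by blast
  have "card (clique_hull m G X) \<le> (\<Sum>x\<in>X. card (clique_hull m G {x}))"
    unfolding hull_eq using X by (rule card_UN_le)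
  also have "\<dots> \<le> (\<Sum>x\<in>X. m)" using single(2) by (rule sum_mono)
  finally show "card (clique_hull m G X) \<le> m * card X" by (simp add: mult.commute)
qed

lemma card_edges_ge_if_uncovered:
  assumes m: "m \<ge> 2" and sat: "saturated (forbidden_family m) G" and r: "r \<in> uncovered m G"
  shows "(m - 2) * (card (verts G) - 1) \<le> card (edges G) + (m - 2) * (m * degree G r)"
proof -
  have G: "G \<in> fin_graphs" and free: "\<not> has_forbidden m G"
    using sat unfolding saturated_forbidden_family_iff[OF m] by auto
  define H where "H = clique_hull m G (nbrs G r)"
  define U where "U = verts G - insert r H"
  have H: "finite H" "card H \<le> m * degree G r" "nbrs G r \<subseteq> H"
    using card_clique_hull_le[OF G disjoint_cliques[OF G free] _ finite_nbrs[OF G]] m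
    by (auto simp: H_def clique_hull_def)
  have "m - 2 \<le> card (nbrs G v \<inter> nbrs G r)" if v: "v \<in> U" for v
  proof -
    have rv: "r \<in> verts G" "v \<in> verts G" "r \<noteq> v" "{r, v} \<notin> edges G"
      using r v H(3) by (auto simp: uncovered_def U_def nbrs_def)
    then have forb: "has_forbidden m (add_edge {r, v} G)"
      using sat unfolding saturated_forbidden_family_iff[OF m] by blast
    have far: "K \<inter> nbrs G r = {}" if "K \<in> cliques m G" "v \<in> K" for K
      using that v by (auto simp: U_def H_def clique_hull_def)
    obtain K where "K \<in> cliques m (add_edge {r, v} G)" "r \<in> K" "v \<in> K"
      by (rule ex_clique_through_added_edge[OF free forb r far])
    then show ?thesis using rv(3) by (rule card_common_nbrs_ge[OF G])
  qed
  then have "(m - 2) * card U \<le> card (edges G)"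
    using H(3)
    by (intro card_edges_ge_of_cross_degrees[OF G, where N = "nbrs G r"]) (auto simp: U_def)
  moreover have "card (verts G) - 1 \<le> card U + m * degree G r"
  proof -
    have "card (insert r H) \<le> m * degree G r + 1" using H(1,2) by (simp add: card_insert_if)
    moreover have "card (verts G) - card (insert r H) \<le> card U"
      unfolding U_def using H(1) by (intro diff_card_le_card_Diff) simp
    ultimately show ?thesis by linarith
  qed
  then have "(m - 2) * (card (verts G) - 1) \<le> (m - 2) * (card U + m * degree G r)"
    by (rule mult_le_mono2)
  ultimately show ?thesis unfolding add_mult_distrib2 by linarith
qed

lemma twice_card_edges_ge_if_uncovered:
  assumes G: "G \<in> fin_graphs" and r: "r \<in> uncovered m G"
    and r_min: "\<And>v. v \<in> uncovered m G \<Longrightarrow> degree G r \<le> degree G v" and "m - 1 \<le> degree G r"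
  shows "(m - 1) * (card (verts G) - 1) + degree G r \<le> 2 * card (edges G)"
proof (rule twice_card_edges_ge[OF G])
  show "r \<in> verts G" using r by (simp add: uncovered_def)
  show "m - 1 \<le> degree G v" if "v \<in> verts G" for v
  proof (cases "v \<in> uncovered m G")
    case True
    then show ?thesis using le_trans[OF \<open>m - 1 \<le> degree G r\<close> r_min] by blast
  next
    case False
    then show ?thesis using that clique_degree_ge[OF G] by (auto simp: uncovered_def)
  qed
qed

section \<open>Divergence\<close>

text \<open>
  If the degree \<open>d\<close> is eliminated from \<open>(m - 2) N \<le> e + m (m - 2) d\<close> and \<open>(m - 1) N + d \<le> 2 e\<close>,
  this is the resulting gain over \<open>e = (m - 1) N / 2\<close> per unit of \<open>N\<close>.
\<close>

definition excess_rate :: "nat \<Rightarrow> real" where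
  "excess_rate m = (real m - 3) / (2 * (2 * real m * (real m - 2) + 1))"

lemma excess_rate_pos: "m \<ge> 4 \<Longrightarrow> excess_rate m > 0"
  unfolding excess_rate_def
  by (intro divide_pos_pos mult_pos_pos add_nonneg_pos mult_nonneg_nonneg) auto

lemma excess_rate_le:
  assumes "m \<ge> 4"
  shows "excess_rate m \<le> (real m - 3) / 2"
  unfolding excess_rate_def using assms by (intro frac_le) auto

lemma edge_bound_if_cross_bound:
  fixes N d e :: real
  assumes m: "m \<ge> 4" and N: "N \<ge> 0"
    and cross: "(real m - 2) * N \<le> e + real m * (real m - 2) * d"
    and degree: "d \<le> real m - 2 \<or> (real m - 1) * N + d \<le> 2 * e"
  shows "((real m - 1) / 2 + excess_rate m) * N - real m * (real m - 2)\<^sup>2 \<le> e"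
  using degree
proof
  assume "d \<le> real m - 2"
  then have "real m * (real m - 2) * d \<le> real m * (real m - 2)\<^sup>2"
    using m by (simp add: power2_eq_square mult_left_mono)
  moreover have "((real m - 1) / 2 + excess_rate m) * N \<le> (real m - 2) * N"
    using excess_rate_le[OF m] N by (intro mult_right_mono) (simp_all add: field_simps)
  ultimately show ?thesis using cross by linarith
next
  assume large: "(real m - 1) * N + d \<le> 2 * e"
  define D where "D = 2 * real m * (real m - 2)"
  define excess where "excess = 2 * e - (real m - 1) * N"
  have D: "D \<ge> 0" using m by (simp add: D_def)
  have "d \<le> excess" using large by (simp add: excess_def)
  have "(real m - 3) * N \<le> excess + D * d"
    using cross by (simp add: D_def excess_def algebra_simps)
  also have "\<dots> \<le> excess + D * excess"
    using \<open>d \<le> excess\<close> D by (intro add_left_mono mult_left_mono)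
  finally have "(real m - 3) * N \<le> (D + 1) * excess" by (simp add: algebra_simps)
  then have "excess_rate m * N \<le> excess / 2"
    using D unfolding excess_rate_def D_def[symmetric] by (simp add: field_simps)
  moreover have "0 \<le> real m * (real m - 2)\<^sup>2" by simp
  ultimately show ?thesis unfolding distrib_right excess_def by argo
qed

lemma card_edges_ge_if_not_dvd:
  assumes m: "m \<ge> 4" and sat: "saturated (forbidden_family m) G"
    and n: "card (verts G) = n" "\<not> m dvd n"
  shows "((real m - 1) / 2 + excess_rate m) * (real n - 1) - real m * (real m - 2)\<^sup>2
    \<le> real (card (edges G))"
proof -
  have G: "G \<in> fin_graphs" and free: "\<not> has_forbidden m G"
    using sat m by (simp_all add: saturated_forbidden_family_iff)
  have "uncovered m G \<noteq> {}" using uncovered_nonempty[OF G free] n by simp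
  then obtain r where r: "r \<in> uncovered m G"
    and r_min: "\<And>v. v \<in> uncovered m G \<Longrightarrow> degree G r \<le> degree G v"
    using ex_has_least_nat[of "\<lambda>v. v \<in> uncovered m G" _ "degree G"] by blast
  have "n \<ge> 1" using n(2) by (cases n) auto
  then have N: "real (n - 1) = real n - 1" by (simp add: of_nat_diff)
  have "real ((m - 2) * (n - 1)) \<le> real (card (edges G) + (m - 2) * (m * degree G r))"
    using card_edges_ge_if_uncovered[OF _ sat r] m n(1) by (simp only: of_nat_le_iff)
  then have cross: "(real m - 2) * (real n - 1)
      \<le> real (card (edges G)) + real m * (real m - 2) * real (degree G r)"
    using m unfolding of_nat_mult of_nat_add N
    by (simp add: of_nat_diff mult.assoc mult.left_commute[of "real m"])
  have large: "(real m - 1) * (real n - 1) + real (degree G r) \<le> 2 * real (card (edges G))"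
    if "m - 1 \<le> degree G r"
  proof -
    have "real ((m - 1) * (n - 1) + degree G r) \<le> real (2 * card (edges G))"
      using twice_card_edges_ge_if_uncovered[OF G r r_min that] n(1) by (simp only: of_nat_le_iff)
    then show ?thesis using m N by (simp add: of_nat_diff)
  qed
  show ?thesis
  proof (rule edge_bound_if_cross_bound[OF m _ cross])
    show "0 \<le> real n - 1" using \<open>n \<ge> 1\<close> by simp
    show "real (degree G r) \<le> real m - 2 \<or>
        (real m - 1) * (real n - 1) + real (degree G r) \<le> 2 * real (card (edges G))"
      using large m by (cases "m - 1 \<le> degree G r") (auto simp: of_nat_diff)
  qed
qed

lemma not_convergent_if_subseqs_separated:
  fixes f :: "nat \<Rightarrow> real"
  assumes subseq: "strict_mono r" "strict_mono s"
    and upper: "\<forall>\<^sub>F t in sequentially. f (r t) \<le> a"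
    and lower: "\<forall>\<^sub>F t in sequentially. g t \<le> f (s t)" "g \<longlonglongrightarrow> b" and "a < b"
  shows "\<not> convergent f"
proof
  assume "convergent f"
  then obtain l where l: "f \<longlonglongrightarrow> l" by (auto simp: convergent_def)
  have "l \<le> a"
    using LIMSEQ_subseq_LIMSEQ[OF l subseq(1)] upper
    by (intro tendsto_upperbound[of "f \<circ> r" l sequentially]) auto
  moreover have "b \<le> l"
    using LIMSEQ_subseq_LIMSEQ[OF l subseq(2)] lower
    by (intro tendsto_le[of sequentially "f \<circ> s" l g b]) auto
  ultimately show False using \<open>a < b\<close> by simp
qed

lemma sat_ratio_multiple_le:
  assumes "m \<ge> 2" "t \<ge> 1"
  shows "real (sat (m * t) (forbidden_family m)) / real (m * t) \<le> (real m - 1) / 2"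
proof -
  have "2 * sat (m * t) (forbidden_family m) \<le> 2 * (t * (m choose 2))"
    using assms by (intro mult_le_mono2 sat_forbidden_family_multiple_le)
  also have "\<dots> = (m - 1) * (m * t)"
    using times_binomial_minus1_eq[of 2 m] by (simp add: algebra_simps)
  finally have "real (2 * sat (m * t) (forbidden_family m)) \<le> real ((m - 1) * (m * t))"
    by (simp only: of_nat_le_iff)
  then show ?thesis using assms by (simp add: of_nat_diff field_simps)
qed

lemma sat_ratio_ge_if_not_dvd:
  assumes m: "m \<ge> 4" and n: "\<not> m dvd n" and c: "c = (real m - 1) / 2 + excess_rate m"
  shows "c - (c + real m * (real m - 2)\<^sup>2) / real n \<le> real (sat n (forbidden_family m)) / real n"
proof -
  define C where "C = c + real m * (real m - 2)\<^sup>2"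
  obtain G where G: "saturated (forbidden_family m) G" "card (verts G) = n"
    "card (edges G) = sat n (forbidden_family m)"
    using sat_forbidden_family_attained[of m n] m by auto
  have "n > 0" using n by (cases n) auto
  have "c * real n - C \<le> real (sat n (forbidden_family m))"
    using card_edges_ge_if_not_dvd[OF m G(1,2) n]
    unfolding G(3) c[symmetric] C_def by (simp add: algebra_simps)
  then have "(c * real n - C) / real n \<le> real (sat n (forbidden_family m)) / real n"
    by (rule divide_right_mono) simp
  then show ?thesis using \<open>n > 0\<close> by (simp add: C_def[symmetric] diff_divide_distrib)
qed

lemma not_convergent_sat_ratio:
  assumes m: "m \<ge> 4"
  shows "\<not> convergent (\<lambda>n. real (sat n (forbidden_family m)) / real n)"
proof (rule not_convergent_if_subseqs_separated)
  define c where "c = (real m - 1) / 2 + excess_rate m"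
  define C where "C = c + real m * (real m - 2)\<^sup>2"
  let ?ratio = "\<lambda>n. real (sat n (forbidden_family m)) / real n"
  show "strict_mono (\<lambda>t. m * t)" "strict_mono (\<lambda>t. m * t + 1)"
    using m by (simp_all add: strict_mono_def)
  show "\<forall>\<^sub>F t in sequentially. ?ratio (m * t) \<le> (real m - 1) / 2"
    using m sat_ratio_multiple_le unfolding eventually_sequentially by (intro exI[of _ 1]) simp
  have "\<not> m dvd m * t + 1" for t using m by (subst dvd_add_right_iff) auto
  then show "\<forall>\<^sub>F t in sequentially. c - C / real (m * t + 1) \<le> ?ratio (m * t + 1)"
    unfolding C_def by (intro always_eventually allI sat_ratio_ge_if_not_dvd[OF m _ c_def])
  have "(\<lambda>n. c - C / real n) \<longlonglongrightarrow> c - 0" by (intro tendsto_intros)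
  from LIMSEQ_subseq_LIMSEQ[OF this \<open>strict_mono (\<lambda>t. m * t + 1)\<close>]
  show "(\<lambda>t. c - C / real (m * t + 1)) \<longlonglongrightarrow> c" by (simp add: comp_def)
  show "(real m - 1) / 2 < c" using excess_rate_pos[OF m] by (simp add: c_def)
qed

theorem theorem1p8:
  "infinite {\<F>. \<F> \<subseteq> iso_classes \<and> card \<F> = 3 \<and>
     \<not> convergent (\<lambda>n. real (sat n \<F>) / real n)}"
proof (rule infinite_super)
  show "forbidden_family ` {4..} \<subseteq> {\<F>. \<F> \<subseteq> iso_classes \<and> card \<F> = 3 \<and>
     \<not> convergent (\<lambda>n. real (sat n \<F>) / real n)}"
    by (intro image_subsetI)
      (simp add: forbidden_family_subset_iso_classes card_forbidden_family not_convergent_sat_ratio)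
  have "inj_on forbidden_family {4..}"
    using inj_on_forbidden_family by (rule inj_on_subset) auto
  then show "infinite (forbidden_family ` {4..})"
    by (simp add: finite_image_iff infinite_Ici)
qed

end
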